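(* Let $A_c\in\mathbb{R}^{n\times n}$, $G\in\mathbb{R}^{m\times n}$, $b\in\mathbb{R}^m$, let $\mathcal{P}=\{x\in\mathbb{R}^n \mid Gx\le b\}$ be an invariant set for the continuous system $\dot{x}(t)=A_cx(t)$, and let $p\ge 1$ be an integer. Let $H\in\mathbb{R}^{m\times m}$ satisfy $H\ge_o 0$, $HG=GA_c$ and $Hb\le 0$, and let $\gamma>0$ be such that $H+\gamma I\ge 0$. For $i=0,1,\dots,p$ put $$f_i(\Delta t)=\sum_{k=i}^p\frac{(-1)^{k-i}}{k!}\binom{k}{i}\gamma^{k-i}\Delta t^k,$$ let $\tau_i\in(0,\infty]$ be the first (smallest) positive zero of $f_i$ ($\tau_i=\infty$ if there is none), and let $\tau=\min_{i=0,\dots,p}\tau_i$. Then $\tau>0$ is a valid steplength threshold for invariance preserving on $\mathcal{P}$ of the $p$-order Taylor approximation type discretization method $$x_{k+1}=A_dx_k,\qquad A_d=\sum_{i=0}^p\frac{1}{i!}A_c^i\Delta t^i .$$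
   Context: Matrix and vector inequalities are entrywise: $M\ge 0$ means all entries of $M$ are nonnegative; $M\ge_o 0$ means all off-diagonal entries of $M$ are nonnegative. A set $\mathcal{S}\subseteq\mathbb{R}^n$ is an invariant set for the continuous system $\dot x(t)=A_cx(t)$ if $x(0)\in\mathcal{S}$ implies $x(t)\in\mathcal{S}$ for all $t\ge 0$; it is an invariant set for the discrete system $x_{k+1}=A_dx_k$ if $x_k\in\mathcal{S}$ implies $x_{k+1}\in\mathcal{S}$ for all $k\in\mathbb{N}$ (equivalently $A_d\mathcal{S}\subseteq\mathcal{S}$). Let $\mathcal{P}$ be an invariant set for the continuous system and let a discretization method with steplength $\Delta t$ be applied to it, giving a discrete system. A number $\tau>0$ is a (valid) steplength threshold for invariance preserving of the method on $\mathcal{P}$ if $\mathcal{P}$ is an invariant set for the discrete system for every $\Delta t\in[0,\tau]$. Known fact used to define the data: $\mathcal{P}=\{x\mid Gx\le b\}$ is an invariant set for the continuous system if and only if there is $H\in\mathbb{R}^{m\times m}$ with $H\ge_o0$, $HG=GA_c$, $Hb\le 0$; and for such $H$ there always exists $\gamma>0$ with $H+\gamma I\ge 0$. *)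

theory Defs
  imports "HOL-Analysis.Analysis"
begin

text \<open>The order on \<^typ>\<open>real ^ 'n\<close>, hence also on
  \<^typ>\<open>real ^ 'n ^ 'm\<close>, is entrywise.\<close>

definition offdiag_nonneg :: "real ^ 'm ^ 'm \<Rightarrow> bool" where
  "offdiag_nonneg M \<longleftrightarrow> (\<forall>i j. i \<noteq> j \<longrightarrow> 0 \<le> M $ i $ j)"

definition polyhedron_set :: "real ^ 'n ^ 'm \<Rightarrow> real ^ 'm \<Rightarrow> (real ^ 'n) set" where
  "polyhedron_set G b = {x. G *v x \<le> b}"

definition invariant_continuous :: "real ^ 'n ^ 'n \<Rightarrow> (real ^ 'n) set \<Rightarrow> bool" where
  "invariant_continuous A S \<longleftrightarrow>
     (\<forall>x :: real \<Rightarrow> real ^ 'n.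
        (\<forall>t\<ge>0. (x has_vector_derivative A *v x t) (at t within {0..})) \<longrightarrow>
        x 0 \<in> S \<longrightarrow> (\<forall>t\<ge>0. x t \<in> S))"

definition invariant_discrete :: "real ^ 'n ^ 'n \<Rightarrow> (real ^ 'n) set \<Rightarrow> bool" where
  "invariant_discrete A S \<longleftrightarrow>
     (\<forall>x :: nat \<Rightarrow> real ^ 'n.
        (\<forall>k. x (Suc k) = A *v x k) \<longrightarrow> (\<forall>k. x k \<in> S \<longrightarrow> x (Suc k) \<in> S))"

text \<open>A discretization method maps the matrix of the continuous system and a steplength
  to the matrix of the discrete system. The threshold is an extended real because a first
  positive zero may fail to exist; for \<open>\<tau> = \<infinity>\<close> the interval \<open>[0, \<tau>]\<close> means all
  nonnegative steplengths.\<close>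

definition steplength_threshold ::
  "(real ^ 'n ^ 'n \<Rightarrow> real \<Rightarrow> real ^ 'n ^ 'n) \<Rightarrow> real ^ 'n ^ 'n \<Rightarrow> (real ^ 'n) set \<Rightarrow> ereal \<Rightarrow> bool"
where
  "steplength_threshold method A S \<tau> \<longleftrightarrow>
     0 < \<tau> \<and> (\<forall>dt. 0 \<le> dt \<and> ereal dt \<le> \<tau> \<longrightarrow> invariant_discrete (method A dt) S)"

text \<open>The library's \<open>^\<close> on \<^typ>\<open>real ^ 'n ^ 'n\<close> is the entrywise power; this is the
  power with respect to \<open>**\<close>.\<close>

primrec matrix_power :: "real ^ 'n ^ 'n \<Rightarrow> nat \<Rightarrow> real ^ 'n ^ 'n" where
  "matrix_power A 0 = mat 1"
| "matrix_power A (Suc k) = A ** matrix_power A k"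

definition taylor_method :: "nat \<Rightarrow> real ^ 'n ^ 'n \<Rightarrow> real \<Rightarrow> real ^ 'n ^ 'n" where
  "taylor_method p A dt = (\<Sum>i=0..p. (dt ^ i / fact i) *\<^sub>R matrix_power A i)"

definition taylor_coeff :: "nat \<Rightarrow> real \<Rightarrow> nat \<Rightarrow> real \<Rightarrow> real" where
  "taylor_coeff p \<gamma> i dt =
     (\<Sum>k=i..p. (-1) ^ (k - i) / fact k * real (k choose i) * \<gamma> ^ (k - i) * dt ^ k)"

text \<open>The value is meaningful only if \<open>f\<close> has a smallest positive zero or none, as is the
  case for nonzero polynomial functions.\<close>

definition first_positive_zero :: "(real \<Rightarrow> real) \<Rightarrow> ereal" where
  "first_positive_zero f =
     (if \<exists>t>0. f t = 0 then ereal (LEAST t. 0 < t \<and> f t = 0) else \<infinity>)"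

definition taylor_threshold :: "nat \<Rightarrow> real \<Rightarrow> ereal" where
  "taylor_threshold p \<gamma> = Min ((\<lambda>i. first_positive_zero (taylor_coeff p \<gamma> i)) ` {0..p})"

end

theory Submission
  imports Defs
begin

text \<open>
  Put \<open>P = H + \<gamma> I\<close>, an entrywise nonnegative matrix. Expanding \<open>H\<^sup>k = (P - \<gamma> I)\<^sup>k\<close> by the binomial
  theorem and exchanging the order of summation gives
  \<open>H\<^sub>d := (\<Sum>k\<le>p. t\<^sup>k / k! H\<^sup>k) = (\<Sum>i\<le>p. f\<^sub>i(t) P\<^sup>i)\<close>, and \<open>H G = G A\<^sub>c\<close> gives \<open>G A\<^sub>d = H\<^sub>d G\<close>.

  Each \<open>f\<^sub>i(t)\<close> is \<open>t\<^sup>i\<close> times a polynomial with constant term \<open>1 / i!\<close>; it is therefore positive for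
  small \<open>t > 0\<close> and nonnegative up to its first positive zero. So for \<open>0 \<le> t \<le> \<tau>\<close> the matrix \<open>H\<^sub>d\<close> is a
  nonnegative combination of powers of \<open>P\<close>, hence monotone, and \<open>G x \<le> b\<close> implies
  \<open>G A\<^sub>d x = H\<^sub>d G x \<le> H\<^sub>d b\<close>. Finally \<open>H b \<le> 0\<close> says \<open>P b \<le> \<gamma> b\<close>, whence \<open>P\<^sup>i b \<le> \<gamma>\<^sup>i b\<close> and
  \<open>H\<^sub>d b \<le> (\<Sum>i\<le>p. f\<^sub>i(t) \<gamma>\<^sup>i) b = (\<Sum>k\<le>p. t\<^sup>k / k! (\<gamma> - \<gamma>)\<^sup>k) b = b\<close>.

  The expansion in powers of \<open>P\<close> and the evaluation of \<open>\<Sum>i\<le>p. f\<^sub>i(t) \<gamma>\<^sup>i\<close> are the two instances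
  \<open>x\<^sub>i = P\<^sup>i v\<close> and \<open>x\<^sub>i = \<gamma>\<^sup>i\<close> of the same resummation, \<open>taylor_coeff_resum\<close>.
\<close>

lemma taylor_coeff_resum:
  fixes x :: "nat \<Rightarrow> 'a::real_vector"
  shows "(\<Sum>i=0..p. taylor_coeff p \<gamma> i t *\<^sub>R x i) =
    (\<Sum>k=0..p. (t ^ k / fact k) *\<^sub>R (\<Sum>i\<le>k. (real (k choose i) * (- \<gamma>) ^ (k - i)) *\<^sub>R x i))"
proof -
  define c where "c k i = (t ^ k / fact k) * (real (k choose i) * (- \<gamma>) ^ (k - i))" for k i
  have "taylor_coeff p \<gamma> i t = (\<Sum>k=i..p. c k i)" for i
    unfolding taylor_coeff_def c_def
    by (intro sum.cong refl) (simp add: power_minus[of \<gamma>] mult_ac)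
  \<comment> \<open>The terms with \<open>k < i\<close> vanish because \<open>k choose i = 0\<close>, so both index ranges may be taken full.\<close>
  also have "(\<Sum>k=i..p. c k i) = (\<Sum>k=0..p. c k i)" for i
    by (rule sum.mono_neutral_left) (auto simp: c_def binomial_eq_0)
  finally have "(\<Sum>i=0..p. taylor_coeff p \<gamma> i t *\<^sub>R x i) = (\<Sum>i=0..p. \<Sum>k=0..p. c k i *\<^sub>R x i)"
    by (simp add: scaleR_sum_left)
  also have "\<dots> = (\<Sum>k=0..p. \<Sum>i=0..p. c k i *\<^sub>R x i)"
    by (rule sum.swap)
  also have "\<dots> = (\<Sum>k=0..p. \<Sum>i\<le>k. c k i *\<^sub>R x i)"
    by (intro sum.cong refl sum.mono_neutral_right) (auto simp: c_def binomial_eq_0)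
  finally show ?thesis
    by (simp add: c_def scaleR_sum_right)
qed

lemma taylor_coeff_factor:
  assumes "i \<le> p"
  obtains g where "\<And>t. taylor_coeff p \<gamma> i t = t ^ i * g t" "continuous_on UNIV g" "g 0 > 0"
proof
  define g where
    "g t = (\<Sum>k=i..p. (-1) ^ (k - i) / fact k * real (k choose i) * \<gamma> ^ (k - i) * t ^ (k - i))" for t
  show "taylor_coeff p \<gamma> i t = t ^ i * g t" for t
    unfolding taylor_coeff_def g_def sum_distrib_left
  proof (intro sum.cong refl)
    fix k assume "k \<in> {i..p}"
    then have "t ^ k = t ^ i * t ^ (k - i)"
      by (simp flip: power_add)
    then show "(-1) ^ (k - i) / fact k * real (k choose i) * \<gamma> ^ (k - i) * t ^ k =
        t ^ i * ((-1) ^ (k - i) / fact k * real (k choose i) * \<gamma> ^ (k - i) * t ^ (k - i))"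
      by (simp add: mult_ac)
  qed
  show "continuous_on UNIV g"
    unfolding g_def by (intro continuous_intros)
  have "g 0 = (\<Sum>k\<in>{i}. (-1) ^ (k - i) / fact k * real (k choose i) * \<gamma> ^ (k - i) * 0 ^ (k - i))"
    unfolding g_def using assms by (intro sum.mono_neutral_right) auto
  then show "g 0 > 0"
    by simp
qed

lemma first_positive_zero_nonneg:
  fixes f :: "real \<Rightarrow> real"
  assumes cont: "continuous_on UNIV f" and "\<delta> > 0"
    and pos: "\<And>t. 0 < t \<Longrightarrow> t < \<delta> \<Longrightarrow> f t > 0"
  shows "0 < first_positive_zero f"
    and "\<And>t. 0 < t \<Longrightarrow> ereal t \<le> first_positive_zero f \<Longrightarrow> f t \<ge> 0"
proof -
  define Z where "Z = {t. 0 < t \<and> f t = 0}"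
  have Z_eq: "Z = {\<delta>..} \<inter> {t. f t = 0}"
    using pos \<open>\<delta> > 0\<close> by (force simp: Z_def not_less[symmetric])
  \<comment> \<open>The least positive zero is attained: the positive zeros stay away from 0, so they form a closed set.\<close>
  have "closed Z"
    unfolding Z_eq using closed_Collect_eq[OF cont continuous_on_const[of _ 0]] by auto
  have bdd: "bdd_below Z"
    unfolding Z_eq by auto
  have least: "(LEAST t. 0 < t \<and> f t = 0) = Inf Z \<and> Inf Z \<in> Z" if "Z \<noteq> {}"
  proof -
    have "Inf Z \<in> Z"
      using closed_contains_Inf[OF that bdd \<open>closed Z\<close>] .
    moreover have "(LEAST t. 0 < t \<and> f t = 0) = Inf Z"
      using \<open>Inf Z \<in> Z\<close> cInf_lower[OF _ bdd]
      by (intro Least_equality) (auto simp: Z_def)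
    ultimately show ?thesis by simp
  qed
  have fpz: "first_positive_zero f = (if Z \<noteq> {} then ereal (Inf Z) else \<infinity>)"
    using least by (auto simp: first_positive_zero_def Z_def)
  show "0 < first_positive_zero f"
    using least by (auto simp: fpz Z_def)
  show "f t \<ge> 0" if "0 < t" "ereal t \<le> first_positive_zero f" for t
  proof (rule ccontr)
    assume neg: "\<not> f t \<ge> 0"
    define s where "s = min (t / 2) (\<delta> / 2)"
    have s: "0 < s" "s < t" "s < \<delta>"
      using \<open>0 < t\<close> \<open>\<delta> > 0\<close> by (auto simp: s_def)
    \<comment> \<open>A sign change before \<open>t\<close> would produce a zero smaller than the first one.\<close>
    obtain z where z: "s \<le> z" "z \<le> t" "f z = 0"
      using IVT2'[of f t 0 s] pos[OF s(1,3)] neg s continuous_on_subset[OF cont] by force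
    then have "z \<in> Z" "z < t"
      using s neg by (auto simp: Z_def less_le)
    then show False
      using that(2) cInf_lower[OF \<open>z \<in> Z\<close> bdd] by (auto simp: fpz split: if_splits)
  qed
qed

lemma taylor_coeff_nonneg_upto_first_zero:
  assumes "i \<le> p"
  shows "0 < first_positive_zero (taylor_coeff p \<gamma> i)"
    and "\<And>t. 0 \<le> t \<Longrightarrow> ereal t \<le> first_positive_zero (taylor_coeff p \<gamma> i) \<Longrightarrow> 0 \<le> taylor_coeff p \<gamma> i t"
proof -
  obtain g where g: "\<And>t. taylor_coeff p \<gamma> i t = t ^ i * g t" "continuous_on UNIV g" "g 0 > 0"
    using taylor_coeff_factor[OF assms] by blast
  have cont: "continuous_on UNIV (taylor_coeff p \<gamma> i)"
    unfolding taylor_coeff_def by (intro continuous_intros)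
  have "open {t. 0 < g t}"
    by (rule open_Collect_less) (use g(2) in \<open>auto intro: continuous_intros\<close>)
  then obtain \<delta> where \<delta>: "\<delta> > 0" "ball 0 \<delta> \<subseteq> {t. 0 < g t}"
    using g(3) openE by blast
  have pos: "taylor_coeff p \<gamma> i t > 0" if "0 < t" "t < \<delta>" for t
    using that \<delta>(2) by (auto simp: g(1) subset_iff dist_real_def)
  show "0 < first_positive_zero (taylor_coeff p \<gamma> i)"
    by (rule first_positive_zero_nonneg(1)[OF cont \<delta>(1) pos])
  show "0 \<le> taylor_coeff p \<gamma> i t" if "0 \<le> t" "ereal t \<le> first_positive_zero (taylor_coeff p \<gamma> i)" for t
  proof (cases "t = 0")
    case True
    then show ?thesis using g(3) by (simp add: g(1))
  next
    case False
    then show ?thesis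
      using first_positive_zero_nonneg(2)[OF cont \<delta>(1) pos, of t] that by simp
  qed
qed

lemma taylor_threshold_le:
  "i \<le> p \<Longrightarrow> taylor_threshold p \<gamma> \<le> first_positive_zero (taylor_coeff p \<gamma> i)"
  unfolding taylor_threshold_def by (intro Min_le) auto

lemma taylor_threshold_pos: "0 < taylor_threshold p \<gamma>"
  unfolding taylor_threshold_def
  by (subst Min_gr_iff) (auto intro: taylor_coeff_nonneg_upto_first_zero(1))

lemma matrix_vector_mult_scaleR_left: "(c *\<^sub>R A) *v x = c *\<^sub>R (A *v x)"
  for A :: "real ^ 'n ^ 'm"
  by (simp add: vec_eq_iff matrix_vector_mult_def sum_distrib_left mult.assoc)

lemma matrix_vector_mult_mono:
  fixes P :: "real ^ 'n ^ 'm"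
  assumes "P \<ge> 0" "u \<le> v"
  shows "P *v u \<le> P *v v"
  using assms by (auto simp: less_eq_vec_def matrix_vector_mult_def intro!: sum_mono mult_left_mono)

lemma matrix_power_mult_mono:
  fixes P :: "real ^ 'm ^ 'm"
  assumes "P \<ge> 0" "u \<le> v"
  shows "matrix_power P i *v u \<le> matrix_power P i *v v"
proof (induction i)
  case 0
  then show ?case using assms by simp
next
  case (Suc i)
  then show ?case
    using matrix_vector_mult_mono[OF assms(1)] by (simp flip: matrix_vector_mul_assoc)
qed

lemma matrix_power_mult_Suc_right:
  "matrix_power P (Suc i) *v v = matrix_power P i *v (P *v v)"
  by (induction i) (simp_all flip: matrix_vector_mul_assoc)

lemma matrix_power_mult_eigen_bound:
  fixes P :: "real ^ 'm ^ 'm"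
  assumes "P \<ge> 0" "P *v b \<le> \<gamma> *\<^sub>R b" "\<gamma> \<ge> 0"
  shows "matrix_power P i *v b \<le> \<gamma> ^ i *\<^sub>R b"
proof (induction i)
  case 0
  then show ?case by simp
next
  case (Suc i)
  have "matrix_power P (Suc i) *v b \<le> matrix_power P i *v (\<gamma> *\<^sub>R b)"
    unfolding matrix_power_mult_Suc_right by (rule matrix_power_mult_mono[OF assms(1,2)])
  also have "\<dots> = \<gamma> *\<^sub>R (matrix_power P i *v b)"
    by (simp add: matrix_vector_mult_scaleR)
  also have "\<dots> \<le> \<gamma> *\<^sub>R (\<gamma> ^ i *\<^sub>R b)"
    using Suc assms(3) by (auto simp: less_eq_vec_def mult.assoc intro!: mult_left_mono)
  finally show ?case by simp
qed

lemma matrix_power_intertwine: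
  fixes A :: "real ^ 'n ^ 'n" and G :: "real ^ 'n ^ 'm"
  assumes "H ** G = G ** A"
  shows "G *v (matrix_power A k *v x) = matrix_power H k *v (G *v x)"
proof (induction k)
  case (Suc k)
  have "G *v (matrix_power A (Suc k) *v x) = (G ** A) *v (matrix_power A k *v x)"
    by (simp flip: matrix_vector_mul_assoc)
  also have "\<dots> = H *v (G *v (matrix_power A k *v x))"
    by (simp add: assms[symmetric] matrix_mul_assoc matrix_vector_mul_assoc)
  finally show ?case
    using Suc by (simp flip: matrix_vector_mul_assoc)
qed simp

lemma matrix_power_binomial:
  fixes H :: "real ^ 'm ^ 'm"
  shows "matrix_power (H + c *\<^sub>R mat 1) k *v v =
    (\<Sum>i\<le>k. (real (k choose i) * c ^ (k - i)) *\<^sub>R (matrix_power H i *v v))"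
proof (induction k)
  case 0
  then show ?case by simp
next
  case (Suc k)
  define x where "x i = matrix_power H i *v v" for i
  have Hx: "H *v x i = x (Suc i)" for i
    by (simp add: x_def matrix_vector_mul_assoc)
  define d where "d i = (real (k choose i) * c ^ (Suc k - i)) *\<^sub>R x i" for i
  have "matrix_power (H + c *\<^sub>R mat 1) (Suc k) *v v =
      (H + c *\<^sub>R mat 1) *v (\<Sum>i\<le>k. (real (k choose i) * c ^ (k - i)) *\<^sub>R x i)"
    using Suc by (simp add: x_def flip: matrix_vector_mul_assoc)
  also have "\<dots> = (\<Sum>i\<le>k. (real (k choose i) * c ^ (k - i)) *\<^sub>R x (Suc i))
      + c *\<^sub>R (\<Sum>i\<le>k. (real (k choose i) * c ^ (k - i)) *\<^sub>R x i)"
    by (simp add: matrix_vector_mult_add_rdistrib matrix_vector_mult_scaleR_left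
        linear_sum[OF matrix_vector_mul_linear] matrix_vector_mult_scaleR Hx
        sum.distrib scaleR_add_right scaleR_sum_right mult_ac)
  also have "c *\<^sub>R (\<Sum>i\<le>k. (real (k choose i) * c ^ (k - i)) *\<^sub>R x i) = (\<Sum>i\<le>k. d i)"
    by (auto simp: scaleR_sum_right d_def Suc_diff_le mult_ac intro!: sum.cong)
  also have "(\<Sum>i\<le>k. d i) = (\<Sum>i\<le>Suc k. d i)"
    by (simp add: d_def)
  also have "\<dots> = d 0 + (\<Sum>i\<le>k. d (Suc i))"
    by (rule sum.atMost_Suc_shift)
  also have "(\<Sum>i\<le>k. (real (k choose i) * c ^ (k - i)) *\<^sub>R x (Suc i)) + (d 0 + (\<Sum>i\<le>k. d (Suc i))) =
      (\<Sum>i\<le>Suc k. (real (Suc k choose i) * c ^ (Suc k - i)) *\<^sub>R x i)"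
    by (subst sum.atMost_Suc_shift)
      (simp add: d_def scaleR_add_left distrib_right sum.distrib)
  finally show ?case
    by (simp only: x_def)
qed

text \<open>The discrete counterpart of the certificate \<open>H\<close> of the continuous system: here \<open>D\<close> plays the
  role of a nonnegative matrix, of which only the monotonicity matters.\<close>

lemma invariant_discrete_polyhedronI:
  assumes "\<And>x. G *v (A *v x) = D (G *v x)"
    and "\<And>u v. u \<le> v \<Longrightarrow> D u \<le> D v" and "D b \<le> b"
  shows "invariant_discrete A (polyhedron_set G b)"
  unfolding invariant_discrete_def polyhedron_set_def
  using assms by (auto intro: order_trans)

theorem theorem3p3:
  fixes A\<^sub>c :: "real ^ 'n ^ 'n" and G :: "real ^ 'n ^ 'm" and b :: "real ^ 'm"
    and H :: "real ^ 'm ^ 'm" and \<gamma> :: real and p :: nat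
  assumes "invariant_continuous A\<^sub>c (polyhedron_set G b)"
    and "p \<ge> 1"
    and "offdiag_nonneg H"
    and "H ** G = G ** A\<^sub>c"
    and "H *v b \<le> 0"
    and "\<gamma> > 0"
    and "H + \<gamma> *\<^sub>R mat 1 \<ge> 0"
  shows "steplength_threshold (taylor_method p) A\<^sub>c (polyhedron_set G b) (taylor_threshold p \<gamma>)"
  unfolding steplength_threshold_def
proof (intro conjI allI impI)
  show "0 < taylor_threshold p \<gamma>"
    by (rule taylor_threshold_pos)
next
  fix t :: real assume t: "0 \<le> t \<and> ereal t \<le> taylor_threshold p \<gamma>"
  define P where "P = H + \<gamma> *\<^sub>R mat 1"
  define f where "f i = taylor_coeff p \<gamma> i t" for i
  have f_nonneg: "0 \<le> f i" if "i \<le> p" for i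
    unfolding f_def using t taylor_threshold_le[OF that, of \<gamma>]
    by (intro taylor_coeff_nonneg_upto_first_zero(2)[OF that]) (auto intro: order_trans)
  define D where "D u = (\<Sum>i=0..p. f i *\<^sub>R (matrix_power P i *v u))" for u
  have P_nonneg: "P \<ge> 0"
    using assms(7) by (simp add: P_def)
  have Pb: "P *v b \<le> \<gamma> *\<^sub>R b"
    using assms(5)
    by (simp add: P_def matrix_vector_mult_add_rdistrib matrix_vector_mult_scaleR_left less_eq_vec_def)
  have D_mono: "(\<Sum>i=0..p. f i *\<^sub>R u i) \<le> (\<Sum>i=0..p. f i *\<^sub>R v i)"
    if "\<And>i. u i \<le> v i" for u v :: "nat \<Rightarrow> real ^ 'm"
    using that f_nonneg by (auto simp: less_eq_vec_def intro!: sum_mono mult_left_mono)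
  have H_eq: "H = P + (- \<gamma>) *\<^sub>R mat 1"
    by (simp add: P_def)
  show "invariant_discrete (taylor_method p A\<^sub>c t) (polyhedron_set G b)"
  proof (rule invariant_discrete_polyhedronI[where D = D])
    fix x
    have "taylor_method p A\<^sub>c t *v x = (\<Sum>k=0..p. (t ^ k / fact k) *\<^sub>R (matrix_power A\<^sub>c k *v x))"
      unfolding taylor_method_def
      by (induction p)
        (simp_all add: matrix_vector_mult_add_rdistrib matrix_vector_mult_scaleR_left)
    then have "G *v (taylor_method p A\<^sub>c t *v x) =
        (\<Sum>k=0..p. (t ^ k / fact k) *\<^sub>R (matrix_power H k *v (G *v x)))"
      by (simp add: linear_sum[OF matrix_vector_mul_linear] matrix_vector_mult_scaleR
          matrix_power_intertwine[OF assms(4)])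
    also have "\<dots> = D (G *v x)"
      unfolding D_def f_def taylor_coeff_resum H_eq matrix_power_binomial ..
    finally show "G *v (taylor_method p A\<^sub>c t *v x) = D (G *v x)" .
  next
    fix u v :: "real ^ 'm" assume "u \<le> v"
    then show "D u \<le> D v"
      unfolding D_def by (intro D_mono matrix_power_mult_mono[OF P_nonneg])
  next
    have "D b \<le> (\<Sum>i=0..p. f i *\<^sub>R (\<gamma> ^ i *\<^sub>R b))"
      unfolding D_def using assms(6)
      by (intro D_mono matrix_power_mult_eigen_bound[OF P_nonneg Pb]) simp
    also have "\<dots> = (\<Sum>i=0..p. f i *\<^sub>R \<gamma> ^ i) *\<^sub>R b"
      by (simp add: scaleR_sum_left)
    also have "(\<Sum>i=0..p. f i *\<^sub>R \<gamma> ^ i) = (\<Sum>k=0..p. (t ^ k / fact k) *\<^sub>R (\<gamma> + - \<gamma>) ^ k)"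
      unfolding f_def taylor_coeff_resum binomial_ring by (simp add: mult_ac)
    \<comment> \<open>Only the term \<open>k = 0\<close> survives.\<close>
    also have "\<dots> = (\<Sum>k\<in>{0}. (t ^ k / fact k) *\<^sub>R (\<gamma> + - \<gamma>) ^ k)"
      by (rule sum.mono_neutral_right) auto
    finally show "D b \<le> b" by simp
  qed
qed

end
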